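(* Let $\mu>-1/2$ and $\operatorname{Re}s>0$. A generating function (in the variable $t$) for the Mellin transforms $M_n^\mu(s)$ defined in the context is $$\sum_{n=0}^\infty M_n^\mu(s)\frac{t^n}{[n/2]!}=2^{(\mu+s-3)/2}\,\frac{(1+4t^2)^{s/2-1}}{(1-4t^2)^{(\mu+s+1)/2}}\left[\sqrt{2(1-16t^4)}\;\Gamma\left(\tfrac{\mu+s}{2}\right)+4t\,\Gamma\left(\tfrac{\mu+s+1}{2}\right)\right],$$ where $[\,\cdot\,]$ in $[n/2]$ is the greatest integer function.
   Context: Generalized Hermite polynomials, for $\mu>-1/2$: $H_{2n}^\mu(x)=(-1)^n2^{2n}n!\,L_n^{\mu-1/2}(x^2)$ and $H_{2n+1}^\mu(x)=(-1)^n2^{2n+1}n!\,x\,L_n^{\mu+1/2}(x^2)$, where $L_n^\alpha(x)=\binom{n+\alpha}{n}\,{}_1F_1(-n;\alpha+1;x)$ are the Laguerre polynomials. Their Mellin transforms are, for $\operatorname{Re}s>0$, $$M_n^\mu(s)=\int_0^\infty x^{s-1}H_n^\mu(x)x^\mu e^{-x^2/2}\,dx .$$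
   Formalization: The exponent s/2−1 of (1+4t²) is corrected to (s−μ)/2−1, since the printed identity fails at order t² for every μ≠0; and Re s+μ>0 is added, since otherwise the integrals M_n with n even diverge at 0. Proved for complex |t|<1/2. *)

theory Defs
  imports "HOL-Analysis.Analysis"
begin

definition hyp1F1 :: "real \<Rightarrow> real \<Rightarrow> real \<Rightarrow> real" where
  "hyp1F1 a b x = (\<Sum>k. pochhammer a k / pochhammer b k * x ^ k / fact k)"

definition laguerre :: "nat \<Rightarrow> real \<Rightarrow> real \<Rightarrow> real" where
  "laguerre n \<alpha> x = ((real n + \<alpha>) gchoose n) * hyp1F1 (- real n) (\<alpha> + 1) x"

definition gen_hermite :: "nat \<Rightarrow> real \<Rightarrow> real \<Rightarrow> real" where
  "gen_hermite n \<mu> x =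
     (let m = n div 2 in
      if even n then (-1) ^ m * 2 ^ (2 * m) * fact m * laguerre m (\<mu> - 1/2) (x\<^sup>2)
      else (-1) ^ m * 2 ^ (2 * m + 1) * fact m * x * laguerre m (\<mu> + 1/2) (x\<^sup>2))"

text \<open>
  The integrand behaves like a constant times \<open>x powr (Re s + \<mu> - 1)\<close> at \<open>0\<close> for even \<open>n\<close>
  and like \<open>x powr (Re s + \<mu>)\<close> for odd \<open>n\<close>. Hence all these integrals exist iff
  \<open>Re s + \<mu> > 0\<close>, which \<open>Re s > 0\<close> implies only for \<open>\<mu> \<ge> 0\<close>.

  They satisfy \<open>mellin_hermite 2 \<mu> s = (4 * s - 2) * mellin_hermite 0 \<mu> s\<close>. Therefore the power
  of \<open>1 + 4 * t\<^sup>2\<close> in their generating function is \<open>(s - \<mu>) / 2 - 1\<close>; the exponent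
  \<open>s / 2 - 1\<close> found in print would replace \<open>4 * s - 2\<close> by \<open>4 * s - 2 + 2 * \<mu>\<close> and is right
  only for \<open>\<mu> = 0\<close>.
\<close>

definition mellin_hermite :: "nat \<Rightarrow> real \<Rightarrow> complex \<Rightarrow> complex" where
  "mellin_hermite n \<mu> s =
     (LINT x:{0<..}|lborel. complex_of_real x powr (s - 1) *
        complex_of_real (gen_hermite n \<mu> x * x powr \<mu> * exp (- x\<^sup>2 / 2)))"

end

theory Submission
  imports Defs
begin

text \<open>
  Expanding the Laguerre polynomial and integrating termwise against the Gaussian gives, with
  \<open>c = (\<mu> + s) / 2\<close>, \<open>a = \<mu> + 1/2\<close> for even and \<open>c = (\<mu> + s + 1) / 2\<close>, \<open>a = \<mu> + 3/2\<close> for odd indices,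
  \<open>2 powr (c - 1) * Gamma c * (a)\<^sub>n / n! \<cdot> \<^sub>2F\<^sub>1(-n, c; a; 2)\<close> up to elementary factors. These
  hypergeometric values are the Taylor coefficients of \<open>(1 - w) powr (c - a) * (1 + w) powr (- c)\<close>: write
  this function as \<open>(1 - w) powr (- a) * (1 + 2w / (1 - w)) powr (- c)\<close> and expand the last factor
  as a formal binomial series. Putting \<open>w = - 4 t\<^sup>2\<close> sums the even and the odd part separately.
\<close>

unbundle no vec_syntax
unbundle fps_syntax

section \<open>Formal binomial series\<close>

text \<open>The formal version of \<open>(1 - w) powr (- a)\<close>. Defining it by substituting
  \<open>- fps_X\<close> lets the addition law pass over from \<open>fps_binomial\<close>.\<close>

definition fps_neg_binomial :: "'a::field_char_0 \<Rightarrow> 'a fps" where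
  "fps_neg_binomial a = fps_binomial (- a) oo (- fps_X)"

lemma fps_neg_binomial_nth: "fps_neg_binomial a $ n = pochhammer a n / fact n"
  by (simp add: fps_neg_binomial_def fps_compose_uminus' gbinomial_pochhammer
        flip: power_mult_distrib mult.assoc)

lemma fps_neg_binomial_add:
  "fps_neg_binomial (a + b) = fps_neg_binomial a * fps_neg_binomial b"
proof -
  have "- (a + b) = - a + - b" by simp
  then show ?thesis
    unfolding fps_neg_binomial_def
    by (simp only: fps_binomial_add_mult) (rule fps_compose_mult_distrib, simp)
qed

lemma fps_neg_binomial_0 [simp]: "fps_neg_binomial 0 = 1"
  by (simp add: fps_neg_binomial_def)

lemma fps_neg_binomial_1_mult: "(1 - fps_X) * fps_neg_binomial (1::'a::field_char_0) = 1"
proof (rule fps_ext)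
  fix n :: nat
  have "fps_neg_binomial (1::'a) $ m = 1" for m
    by (simp only: fps_neg_binomial_nth flip: pochhammer_fact) simp
  then show "((1 - fps_X) * fps_neg_binomial (1::'a)) $ n = 1 $ n"
    by (cases n) (simp_all add: left_diff_distrib)
qed

lemma fps_neg_binomial_of_nat:
  "fps_neg_binomial (of_nat k) = fps_neg_binomial (1::'a::field_char_0) ^ k"
  by (induction k) (simp_all add: fps_neg_binomial_add)

text \<open>The differential equation of the binomial series, cleared of its denominator so that
  another series can be substituted into it.\<close>

lemma one_plus_X_mult_deriv_fps_binomial:
  "(1 + fps_X) * fps_deriv (fps_binomial c) = fps_const c * fps_binomial (c::'a::field_char_0)"
proof -
  have "inverse (1 + fps_X) * (1 + fps_X :: 'a fps) = 1"
    by (rule inverse_mult_eq_1) simp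
  then show ?thesis
    by (simp add: fps_binomial_deriv fps_divide_unit mult.left_commute[of "1 + fps_X"]
        mult.commute[of "1 + fps_X"] mult.assoc)
qed

lemma one_minus_X_mult_deriv_fps_neg_binomial:
  "(1 - fps_X) * fps_deriv (fps_neg_binomial c) = fps_const c * fps_neg_binomial (c::'a::field_char_0)"
proof (rule fps_ext)
  fix n :: nat
  have step: "of_nat (Suc m) * fps_neg_binomial c $ Suc m = (c + of_nat m) * fps_neg_binomial c $ m"
    for m
    by (simp add: fps_neg_binomial_nth pochhammer_Suc del: of_nat_Suc)
  show "((1 - fps_X) * fps_deriv (fps_neg_binomial c)) $ n = (fps_const c * fps_neg_binomial c) $ n"
    using step[of n] step[of "n - 1"]
    by (cases n) (simp_all add: left_diff_distrib distrib_right del: of_nat_Suc)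
qed

text \<open>
  In function notation this is \<open>(1 + 2w / (1 - w)) powr c = (1 + w) powr c * (1 - w) powr (- c)\<close>.
  Both sides solve \<open>(1 - w\<^sup>2) F' = 2 c F\<close>, \<open>F 0 = 1\<close>; dividing by the right-hand side turns this
  into a vanishing derivative.
\<close>

lemma fps_binomial_compose_moebius:
  fixes c :: "'a::field_char_0"
  shows "fps_binomial c oo (2 * fps_X * fps_neg_binomial 1) = fps_binomial c * fps_neg_binomial c"
proof -
  define E where "E = fps_neg_binomial (1::'a)"
  define U where "U = 2 * fps_X * E"
  define A where "A = fps_binomial c oo U"
  \<comment> \<open>Negated exponents make \<open>G\<close> the inverse of the claimed right-hand
    side.\<close>
  define G where "G = fps_binomial (- c) * fps_neg_binomial (- c)"
  have E: "(1 - fps_X) * E = 1"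
    unfolding E_def by (rule fps_neg_binomial_1_mult)
  have U0: "U $ 0 = 0"
    by (simp add: U_def mult.assoc)
  have dE: "(1 - fps_X) * fps_deriv E = E"
    unfolding E_def using one_minus_X_mult_deriv_fps_neg_binomial[of "1::'a"] by simp
  \<comment> \<open>Cleared of denominators, this and \<open>dU'\<close> say
    \<open>1 + U = (1 + w) / (1 - w)\<close> and \<open>U' = 2 / (1 - w)^2\<close>.\<close>
  have U1: "(1 - fps_X) * (1 + U) = 1 + fps_X"
    using E unfolding U_def by algebra
  have dU: "fps_deriv U = 2 * E + 2 * fps_X * fps_deriv E"
    by (simp add: U_def algebra_simps)
  have dU': "(1 - fps_X) * fps_deriv U = 2 * E"
    using E dE unfolding dU by algebra
  have "((1 + fps_X) * fps_deriv (fps_binomial c)) oo U = (fps_const c * fps_binomial c) oo U"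
    by (simp only: one_plus_X_mult_deriv_fps_binomial)
  then have "(1 + U) * (fps_deriv (fps_binomial c) oo U) = fps_const c * A"
    by (simp add: fps_compose_mult_distrib U0 A_def fps_compose_add_distrib)
  moreover have dA: "fps_deriv A = (fps_deriv (fps_binomial c) oo U) * fps_deriv U"
    unfolding A_def by (rule fps_compose_deriv[OF U0])
  ultimately have A': "(1 + U) * fps_deriv A = fps_const c * A * fps_deriv U"
    by (simp add: algebra_simps)
  \<comment> \<open>One factor \<open>1 - fps_X\<close> turns \<open>fps_deriv U\<close> into
    \<open>2 * E\<close>, the other removes \<open>E\<close>.\<close>
  have "(1 - fps_X) * (1 - fps_X) * ((1 + U) * fps_deriv A) = fps_const c * A * 2"
    using E dU' A' by algebra
  then have ODE_A: "(1 - fps_X) * (1 + fps_X) * fps_deriv A = 2 * fps_const c * A"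
    using U1 by algebra
  have dG: "fps_deriv G = fps_deriv (fps_binomial (- c)) * fps_neg_binomial (- c)
      + fps_binomial (- c) * fps_deriv (fps_neg_binomial (- c))"
    by (simp add: G_def algebra_simps)
  have neg: "fps_const (- c) = - fps_const c" by simp
  have ODE_G: "(1 - fps_X) * (1 + fps_X) * fps_deriv G = - 2 * fps_const c * G"
    using one_plus_X_mult_deriv_fps_binomial[of "- c"]
      one_minus_X_mult_deriv_fps_neg_binomial[of "- c"] 
    unfolding dG neg unfolding G_def by algebra
  have "(1 - fps_X) * (1 + fps_X) * fps_deriv (A * G) = 0"
    using ODE_A ODE_G by (simp add: algebra_simps) algebra
  moreover have "(1 - fps_X :: 'a fps) \<noteq> 0" "(1 + fps_X :: 'a fps) \<noteq> 0"
    by (auto simp: fps_eq_iff intro!: exI[of _ 0])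
  ultimately have "fps_deriv (A * G) = 0"
    by simp
  then have "A * G = fps_const ((A * G) $ 0)"
    by (simp only: fps_deriv_eq_0_iff)
  also have "(A * G) $ 0 = 1"
    by (simp add: A_def G_def fps_neg_binomial_nth)
  finally have "A * G = 1" by simp
  moreover have "G * (fps_binomial c * fps_neg_binomial c) = 1"
    using fps_binomial_add_mult[of "-c" c] fps_neg_binomial_add[of "-c" c]
    unfolding G_def by (simp add: mult_ac)
  ultimately have "A = fps_binomial c * fps_neg_binomial c"
    by algebra
  then show ?thesis by (simp add: A_def U_def E_def)
qed

text \<open>
  This is \<open>(a)\<^sub>n / n! \<cdot> \<^sub>2F\<^sub>1(-n, c; a; 2)\<close>, rearranged so that no \<open>pochhammer a k\<close> occurs in a
  denominator.
\<close>

definition laguerre_mellin_coeff :: "nat \<Rightarrow> 'a \<Rightarrow> 'a \<Rightarrow> 'a::field_char_0" where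
  "laguerre_mellin_coeff n c a =
     (\<Sum>k\<le>n. (- c gchoose k) * 2 ^ k * (pochhammer (a + of_nat k) (n - k) / fact (n - k)))"

text \<open>The Moebius identity at \<open>- c\<close> rewrites the product as
  \<open>(1 + U) powr (- c) * (1 - w) powr (- a)\<close> with \<open>U = 2w / (1 - w)\<close>.
  Expanding in powers of \<open>U\<close>, the term of index \<open>k\<close> is
  \<open>(- c gchoose k) * 2 ^ k * w ^ k * (1 - w) powr (- a - k)\<close>, and its coefficient at
  \<open>w ^ n\<close> is the summand.\<close>

lemma fps_nth_laguerre_mellin_coeff:
  fixes c a :: "'a::field_char_0"
  shows "(fps_binomial (- c) * fps_neg_binomial (a - c)) $ n = laguerre_mellin_coeff n c a"
proof -
  define U :: "'a fps" where "U = 2 * fps_X * fps_neg_binomial 1"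
  define B where "B = fps_neg_binomial a"
  have U_power: "U ^ k = fps_X ^ k * (2 ^ k * fps_neg_binomial 1 ^ k)" for k
    by (simp add: U_def power_mult_distrib mult_ac)
  define b where "b k = (- c gchoose k)" for k
  have "fps_binomial (- c) * fps_neg_binomial (a - c) = (fps_binomial (- c) oo U) * B"
    unfolding U_def fps_binomial_compose_moebius B_def
    by (simp add: mult.assoc flip: fps_neg_binomial_add)
  also have "\<dots> $ n = (\<Sum>j\<le>n. (\<Sum>k\<le>n. b k * (U ^ k) $ j) * B $ (n - j))"
  proof -
    \<comment> \<open>Since \<open>U\<close> has no constant term, \<open>U ^ k\<close> starts at
      degree \<open>k\<close>. The range of \<open>k\<close> can thus be made independent of
      \<open>j\<close>, which permits swapping the sums.\<close>
    have "(\<Sum>k=0..j. b k * (U ^ k) $ j) = (\<Sum>k\<le>n. b k * (U ^ k) $ j)" if "j \<le> n" for j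
    proof (rule sum.mono_neutral_left)
      show "\<forall>k\<in>{..n} - {0..j}. b k * (U ^ k) $ j = 0"
      proof
        fix k assume "k \<in> {..n} - {0..j}"
        then have "j < k" by auto
        then show "b k * (U ^ k) $ j = 0"
          by (simp add: U_power fps_X_power_mult_nth)
      qed
    qed (use that in auto)
    then show ?thesis
      by (simp add: fps_mult_nth fps_compose_nth b_def atLeast0AtMost)
  qed
  also have "\<dots> = (\<Sum>k\<le>n. b k * (\<Sum>j\<le>n. (U ^ k) $ j * B $ (n - j)))"
    by (simp add: sum_distrib_left sum_distrib_right mult.assoc) (rule sum.swap)
  also have "\<dots> = (\<Sum>k\<le>n. b k * (U ^ k * B) $ n)"
    by (simp add: fps_mult_nth atLeast0AtMost)
  also have "\<dots> = laguerre_mellin_coeff n c a"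
    unfolding laguerre_mellin_coeff_def
  proof (rule sum.cong)
    fix k assume k: "k \<in> {..n}"
    have "U ^ k * B = fps_const (2 ^ k) * (fps_X ^ k * fps_neg_binomial (a + of_nat k))"
      by (simp add: U_def B_def power_mult_distrib fps_neg_binomial_add fps_neg_binomial_of_nat
          mult_ac numeral_fps_const fps_const_power flip: fps_const_power)
    then show "b k * (U ^ k * B) $ n = (- c gchoose k) * 2 ^ k *
        (pochhammer (a + of_nat k) (n - k) / fact (n - k))"
      using k by (simp add: fps_X_power_mult_nth fps_neg_binomial_nth b_def)
  qed simp
  finally show ?thesis .
qed

section \<open>Convergence of the coefficient generating function\<close>

text \<open>The formal product becomes the Cauchy product of two binomial series, both absolutely
  convergent in the unit disc.\<close>

lemma laguerre_mellin_coeff_sums: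
  fixes a c w :: complex
  assumes "norm w < 1"
  shows "(\<lambda>n. laguerre_mellin_coeff n c a * w ^ n) sums
    ((1 + w) powr (- c) * (1 - w) powr (c - a))"
proof -
  define f where "f n = (- c gchoose n) * w ^ n" for n
  define g where "g n = fps_neg_binomial (a - c) $ n * w ^ n" for n
  have g_eq: "g n = (c - a gchoose n) * (- w) ^ n" for n
    by (simp add: g_def fps_neg_binomial_def fps_compose_uminus' power_minus[of w] mult_ac)
  have sums: "f sums ((1 + w) powr (- c))" "g sums ((1 - w) powr (c - a))"
    unfolding f_def g_eq
    using gen_binomial_complex[OF assms, of "- c"] gen_binomial_complex[of "- w" "c - a"] assms
    by simp_all
  \<comment> \<open>Convergence at a radius strictly between \<open>norm w\<close> and 1 forces
    absolute convergence at \<open>w\<close>.\<close>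
  have norm_summable: "summable (\<lambda>n. norm (h n * w ^ n))"
    if "\<And>z::complex. norm z < 1 \<Longrightarrow> summable (\<lambda>n. h n * z ^ n)" for h :: "nat \<Rightarrow> complex"
  proof -
    obtain r where r: "norm w < r" "r < 1" using assms dense by blast
    then have "0 \<le> r" by (meson norm_ge_zero le_less_trans less_imp_le)
    with r show ?thesis
      by (intro powser_insidea[of h "of_real r"] that) auto
  qed
  have "summable (\<lambda>n. norm (f n))"
    unfolding f_def by (rule norm_summable) (blast intro: sums_summable gen_binomial_complex)
  moreover have "summable (\<lambda>n. norm (g n))"
    unfolding g_def
  proof (rule norm_summable)
    fix z :: complex assume "norm z < 1"
    then have "summable (\<lambda>n. (c - a gchoose n) * (- z) ^ n)"
      by (intro sums_summable[OF gen_binomial_complex]) simp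
    then show "summable (\<lambda>n. fps_neg_binomial (a - c) $ n * z ^ n)"
      by (simp add: fps_neg_binomial_def fps_compose_uminus' power_minus[of z] mult_ac)
  qed
  ultimately have "(\<lambda>n. \<Sum>i\<le>n. f i * g (n - i)) sums ((\<Sum>n. f n) * (\<Sum>n. g n))"
    by (rule Cauchy_product_sums)
  moreover have "(\<Sum>i\<le>n. f i * g (n - i)) = laguerre_mellin_coeff n c a * w ^ n" for n
  proof -
    have "(\<Sum>i\<le>n. f i * g (n - i)) =
        (\<Sum>i\<le>n. (- c gchoose i) * fps_neg_binomial (a - c) $ (n - i) * w ^ n)"
      by (intro sum.cong) (simp_all add: f_def g_def mult_ac flip: power_add)
    then show ?thesis
      by (simp add: fps_mult_nth atLeast0AtMost sum_distrib_right
          flip: fps_nth_laguerre_mellin_coeff)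
  qed
  ultimately show ?thesis
    using sums by (simp add: sums_iff)
qed

section \<open>Gaussian Mellin integrals of Laguerre polynomials\<close>

text \<open>Substitute \<open>t = x^2 / 2\<close> in Euler's integral for
  \<open>Gamma (z / 2)\<close>.\<close>

lemma has_bochner_integral_complex_powr_gaussian:
  fixes z :: complex
  assumes "Re z > 0"
  shows "has_bochner_integral lborel
    (\<lambda>x. indicator {0<..} x *\<^sub>R (of_real x powr (z - 1) * of_real (exp (- x\<^sup>2 / 2))))
    (2 powr (z / 2 - 1) * Gamma (z / 2))"
proof -
  define f where "f t = complex_of_real t powr (z / 2 - 1) / of_real (exp t)" for t :: real
  define g where "g x = x\<^sup>2 / 2" for x :: real
  define h where "h x = complex_of_real x powr (z - 1) * of_real (exp (- x\<^sup>2 / 2))" for x :: real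
  have im: "g ` {0<..} = {0<..}"
  proof safe
    fix y :: real assume "y > 0"
    then show "y \<in> g ` {0<..}"
      by (intro image_eqI[of _ _ "sqrt (2 * y)"]) (auto simp: g_def)
  qed (auto simp: g_def)
  have inj: "inj_on g {0<..}"
    by (auto simp: g_def inj_on_def power2_eq_iff)
  have "f absolutely_integrable_on g ` {0<..} \<and> integral (g ` {0<..}) f = Gamma (z / 2)"
    unfolding im f_def
    using absolutely_integrable_Gamma_integral'[of "z / 2"] Gamma_integral_complex'[of "z / 2"]
      assms by (auto simp: integral_unique)
  moreover have "(g has_field_derivative x) (at x within {0<..})" for x
    unfolding g_def by (auto intro!: derivative_eq_intros)
  ultimately have *: "(\<lambda>x. \<bar>x\<bar> *\<^sub>R f (g x)) absolutely_integrable_on {0<..} \<and>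
      integral {0<..} (\<lambda>x. \<bar>x\<bar> *\<^sub>R f (g x)) = Gamma (z / 2)"
    by (subst has_absolute_integral_change_of_variables_real) (use inj in auto)
  \<comment> \<open>The constant comes from
    \<open>x powr (z - 1) = x * (2 * t) powr (z / 2 - 1)\<close>; the remaining factor
    \<open>x\<close> is the derivative of \<open>g\<close>.\<close>
  have eq: "h x = 2 powr (z / 2 - 1) * (\<bar>x\<bar> *\<^sub>R f (g x))" if "x \<in> {0<..}" for x
  proof -
    have x: "x > 0" using that by simp
    then have L: "Ln (of_real (g x)) = 2 * of_real (ln x) - of_real (ln 2)"
      by (simp add: g_def Ln_of_real ln_div ln_realpow flip: of_real_power of_real_divide)
    have L2: "Ln (2::complex) = of_real (ln 2)"
      using Ln_of_real[of 2] by simp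
    have "2 powr (z / 2 - 1) * of_real (g x) powr (z / 2 - 1) * of_real x
        = exp ((z / 2 - 1) * of_real (ln 2)) * exp ((z / 2 - 1) * (2 * of_real (ln x) - of_real (ln 2)))
          * exp (of_real (ln x))"
    proof -
      have "complex_of_real (g x) \<noteq> 0" using x by (simp add: g_def)
      then show ?thesis
        using x unfolding powr_def L L2 by (simp add: exp_of_real)
    qed
    also have "\<dots> = of_real x powr (z - 1)"
      using x by (simp add: powr_def Ln_of_real algebra_simps flip: exp_add)
    finally show ?thesis
      using x by (simp add: h_def f_def scaleR_conv_of_real exp_minus field_simps g_def)
  qed
  have "(\<lambda>x. 2 powr (z / 2 - 1) * (\<bar>x\<bar> *\<^sub>R f (g x))) absolutely_integrable_on {0<..}"
    using * by (intro set_integrable_mult_right) auto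
  then have "h absolutely_integrable_on {0<..}"
    by (subst set_integrable_cong[OF refl refl eq]) auto
  \<comment> \<open>The change of variables gives integrability for the completed measure only;
    Borel measurability brings it back to \<open>lborel\<close>.\<close>
  moreover have "(\<lambda>x. indicator {0<..} x *\<^sub>R h x) \<in> borel_measurable lborel"
    unfolding h_def measurable_lborel2
    by (intro borel_measurable_continuous_on_indicator continuous_intros) auto
  ultimately have int: "set_integrable lborel {0<..} h"
    unfolding set_integrable_def by (subst (asm) integrable_completion) auto
  have "(LINT x:{0<..}|lborel. h x) = integral {0<..} h"
    by (rule set_borel_integral_eq_integral[OF int])
  also have "\<dots> = integral {0<..} (\<lambda>x. 2 powr (z / 2 - 1) * (\<bar>x\<bar> *\<^sub>R f (g x)))"
    by (rule integral_cong) (rule eq)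
  also have "\<dots> = 2 powr (z / 2 - 1) * Gamma (z / 2)"
    using * by (simp only: integral_mult_right)
  finally show ?thesis
    using int unfolding set_integrable_def set_lebesgue_integral_def h_def
    by (simp add: has_bochner_integral_iff)
qed

text \<open>The hypergeometric series stops at \<open>n\<close>, and for \<alpha> > -1 the nonzero
  \<open>pochhammer (\<alpha> + 1) k\<close> cancels against
  \<open>pochhammer (\<alpha> + 1) n\<close>.\<close>

lemma laguerre_eq_sum:
  assumes "\<alpha> > - 1"
  shows "laguerre n \<alpha> x =
    (\<Sum>k\<le>n. (- 1) ^ k / fact k * (pochhammer (\<alpha> + 1 + real k) (n - k) / fact (n - k)) * x ^ k)"
proof -
  have "hyp1F1 (- real n) (\<alpha> + 1) x =
      (\<Sum>k\<le>n. pochhammer (- real n) k / pochhammer (\<alpha> + 1) k * x ^ k / fact k)"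
    unfolding hyp1F1_def by (rule suminf_finite) (auto simp: pochhammer_of_nat_eq_0_lemma)
  then have "laguerre n \<alpha> x = (\<Sum>k\<le>n. pochhammer (\<alpha> + 1) n / fact n *
      (pochhammer (- real n) k / pochhammer (\<alpha> + 1) k * x ^ k / fact k))"
    by (simp add: laguerre_def gbinomial_pochhammer' sum_distrib_left)
  also have "\<dots> = (\<Sum>k\<le>n. (- 1) ^ k / fact k *
      (pochhammer (\<alpha> + 1 + real k) (n - k) / fact (n - k)) * x ^ k)"
  proof (rule sum.cong)
    fix k assume "k \<in> {..n}"
    then have k: "k \<le> n" by simp
    \<comment> \<open>Both sides are the binomial coefficient \<open>n choose k\<close>.\<close>
    have "(- 1) ^ k * pochhammer (- real n) k / fact k = fact n / (fact k * fact (n - k))"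
      by (simp only: flip: gbinomial_pochhammer binomial_gbinomial binomial_fact[OF k])
    then have "(- 1) ^ k * pochhammer (- real n) k = fact n / fact (n - k)"
      by (simp add: divide_simps)
    then have "pochhammer (- real n) k = (- 1) ^ k * (fact n / fact (n - k))"
      by (cases "even k") simp_all
    moreover have "pochhammer (\<alpha> + 1) n = pochhammer (\<alpha> + 1) k * pochhammer (\<alpha> + 1 + real k) (n - k)"
      by (rule pochhammer_product[OF k])
    moreover have "pochhammer (\<alpha> + 1) k \<noteq> 0"
      using pochhammer_pos[of "\<alpha> + 1" k] assms by simp
    ultimately show "pochhammer (\<alpha> + 1) n / fact n *
        (pochhammer (- real n) k / pochhammer (\<alpha> + 1) k * x ^ k / fact k) =
        (- 1) ^ k / fact k * (pochhammer (\<alpha> + 1 + real k) (n - k) / fact (n - k)) * x ^ k"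
      by (simp add: mult_ac)
  qed simp
  finally show ?thesis .
qed

text \<open>Integrate termwise: the power \<open>x^(2k)\<close> shifts \<open>z\<close> to
  \<open>z + 2k\<close>, which multiplies the basic integral by
  \<open>2 ^ k * pochhammer (z / 2) k\<close>. Together with \<open>(- 1) ^ k / fact k\<close> this
  produces \<open>(- (z / 2) gchoose k) * 2 ^ k\<close>.\<close>

lemma mellin_laguerre_gaussian:
  fixes z :: complex
  assumes "\<alpha> > - 1" and "Re z > 0"
  shows "(LINT x:{0<..}|lborel. of_real x powr (z - 1) *
      of_real (laguerre n \<alpha> (x\<^sup>2) * exp (- x\<^sup>2 / 2))) =
    2 powr (z / 2 - 1) * Gamma (z / 2) * laguerre_mellin_coeff n (z / 2) (of_real \<alpha> + 1)"
proof -
  define d where "d k = (- 1) ^ k / fact k *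
    (pochhammer (complex_of_real \<alpha> + 1 + of_nat k) (n - k) / fact (n - k))" for k
  define h where "h k x = indicator {0<..} x *\<^sub>R
    (of_real x powr (z + 2 * of_nat k - 1) * of_real (exp (- x\<^sup>2 / 2)))" for k and x :: real
  have h: "has_bochner_integral lborel (h k)
      (2 powr (z / 2 - 1) * Gamma (z / 2) * (2 ^ k * pochhammer (z / 2) k))" for k
  proof -
    have "z / 2 \<notin> \<int>\<^sub>\<le>\<^sub>0"
      using assms by (auto elim!: nonpos_Ints_cases simp: complex_eq_iff)
    then have "Gamma (z / 2 + of_nat k) = pochhammer (z / 2) k * Gamma (z / 2)"
      by (simp add: pochhammer_Gamma Gamma_eq_zero_iff)
    moreover have "2 powr (z / 2 + of_nat k - 1) = 2 powr (z / 2 - 1) * (2::complex) ^ k"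
      by (simp add: powr_add powr_diff powr_nat')
    ultimately show ?thesis
      using has_bochner_integral_complex_powr_gaussian[of "z + 2 * of_nat k"] assms
      unfolding h_def by (simp add: add_divide_distrib mult_ac)
  qed
  have "has_bochner_integral lborel (\<lambda>x. \<Sum>k\<le>n. d k * h k x)
      (\<Sum>k\<le>n. d k * (2 powr (z / 2 - 1) * Gamma (z / 2) * (2 ^ k * pochhammer (z / 2) k)))"
    by (intro has_bochner_integral_sum has_bochner_integral_mult_right h)
  also have "(\<lambda>x. \<Sum>k\<le>n. d k * h k x) = (\<lambda>x. indicator {0<..} x *\<^sub>R
      (of_real x powr (z - 1) * of_real (laguerre n \<alpha> (x\<^sup>2) * exp (- x\<^sup>2 / 2))))"
  proof
    fix x :: real
    show "(\<Sum>k\<le>n. d k * h k x) = indicator {0<..} x *\<^sub>R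
      (of_real x powr (z - 1) * of_real (laguerre n \<alpha> (x\<^sup>2) * exp (- x\<^sup>2 / 2)))"
    proof (cases "x > 0")
      case True
      have "of_real x powr (z + 2 * of_nat k - 1) = of_real x powr (z - 1) * of_real (x\<^sup>2) ^ k" for k
        using True powr_nat'[of "of_real x :: complex" "2 * k"]
        by (simp add: powr_add powr_diff power_mult)
      moreover have "of_real (laguerre n \<alpha> (x\<^sup>2)) = (\<Sum>k\<le>n. d k * of_real (x\<^sup>2) ^ k)"
        by (simp add: laguerre_eq_sum[OF assms(1)] d_def flip: pochhammer_of_real)
      ultimately show ?thesis
        using True by (simp add: h_def sum_distrib_left sum_distrib_right mult_ac)
    qed (simp add: h_def)
  qed
  also have "(\<Sum>k\<le>n. d k * (2 powr (z / 2 - 1) * Gamma (z / 2) * (2 ^ k * pochhammer (z / 2) k))) =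
      2 powr (z / 2 - 1) * Gamma (z / 2) * laguerre_mellin_coeff n (z / 2) (of_real \<alpha> + 1)"
    unfolding laguerre_mellin_coeff_def sum_distrib_left
    by (rule sum.cong) (simp_all add: d_def gbinomial_pochhammer)
  finally show ?thesis
    unfolding set_lebesgue_integral_def by (rule has_bochner_integral_integral_eq)
qed

section \<open>Mellin transforms of the Hermite polynomials\<close>

text \<open>The weight \<open>x powr \<mu>\<close> shifts the Mellin variable to
  \<open>\<mu> + s\<close>, and the Laguerre parameter is \<open>\<mu> - 1 / 2\<close>.\<close>

lemma mellin_hermite_even:
  assumes "\<mu> > - 1 / 2" and "Re s + \<mu> > 0"
  shows "mellin_hermite (2 * m) \<mu> s = (- 4) ^ m * fact m *
    (2 powr ((\<mu> + s) / 2 - 1) * Gamma ((\<mu> + s) / 2) *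
      laguerre_mellin_coeff m ((\<mu> + s) / 2) (\<mu> + 1 / 2))"
proof -
  have four: "2 ^ (m * 2) = (4::complex) ^ m"
    by (simp add: mult.commute[of m] power_mult)
  have "mellin_hermite (2 * m) \<mu> s = (LINT x:{0<..}|lborel. ((- 4) ^ m * fact m) *
      (of_real x powr ((\<mu> + s) - 1) * of_real (laguerre m (\<mu> - 1 / 2) (x\<^sup>2) * exp (- x\<^sup>2 / 2))))"
    unfolding mellin_hermite_def
  proof (intro set_lebesgue_integral_cong ballI allI impI)
    fix x :: real assume "x \<in> {0<..}"
    then have "of_real x powr (\<mu> + s - 1) = of_real x powr (s - 1) * complex_of_real (x powr \<mu>)"
      by (simp add: powr_diff powr_add flip: powr_of_real)
    then show "of_real x powr (s - 1) * of_real (gen_hermite (2 * m) \<mu> x * x powr \<mu> * exp (- x\<^sup>2 / 2)) =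
      ((- 4) ^ m * fact m) *
      (of_real x powr (\<mu> + s - 1) * of_real (laguerre m (\<mu> - 1 / 2) (x\<^sup>2) * exp (- x\<^sup>2 / 2)))"
      by (simp add: gen_hermite_def four power_minus[of 4] mult_ac)
  qed simp
  also have "\<dots> = (- 4) ^ m * fact m * (LINT x:{0<..}|lborel.
      of_real x powr ((\<mu> + s) - 1) * of_real (laguerre m (\<mu> - 1 / 2) (x\<^sup>2) * exp (- x\<^sup>2 / 2)))"
    by (rule set_integral_mult_right)
  also have "(LINT x:{0<..}|lborel.
      of_real x powr ((\<mu> + s) - 1) * of_real (laguerre m (\<mu> - 1 / 2) (x\<^sup>2) * exp (- x\<^sup>2 / 2))) =
      2 powr ((\<mu> + s) / 2 - 1) * Gamma ((\<mu> + s) / 2) *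
      laguerre_mellin_coeff m ((\<mu> + s) / 2) (of_real (\<mu> - 1 / 2) + 1)"
    by (rule mellin_laguerre_gaussian) (use assms in auto)
  finally show ?thesis by (simp add: add.commute)
qed

text \<open>The extra factor \<open>x\<close> shifts the Mellin variable once more, to
  \<open>\<mu> + s + 1\<close>; the Laguerre parameter is now \<open>\<mu> + 1 / 2\<close>.\<close>

lemma mellin_hermite_odd:
  assumes "\<mu> > - 1 / 2" and "Re s + \<mu> > 0"
  shows "mellin_hermite (2 * m + 1) \<mu> s = 2 * (- 4) ^ m * fact m *
    (2 powr ((\<mu> + s + 1) / 2 - 1) * Gamma ((\<mu> + s + 1) / 2) *
      laguerre_mellin_coeff m ((\<mu> + s + 1) / 2) (\<mu> + 3 / 2))"
proof -
  have four: "2 ^ (m * 2) = (4::complex) ^ m"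
    by (simp add: mult.commute[of m] power_mult)
  have "mellin_hermite (2 * m + 1) \<mu> s = (LINT x:{0<..}|lborel. (2 * (- 4) ^ m * fact m) *
      (of_real x powr ((\<mu> + s + 1) - 1) * of_real (laguerre m (\<mu> + 1 / 2) (x\<^sup>2) * exp (- x\<^sup>2 / 2))))"
    unfolding mellin_hermite_def
  proof (intro set_lebesgue_integral_cong ballI allI impI)
    fix x :: real assume "x \<in> {0<..}"
    then have "of_real x powr (\<mu> + s + 1 - 1) =
        of_real x powr (s - 1) * complex_of_real (x powr \<mu>) * of_real x"
      by (simp add: powr_diff powr_add flip: powr_of_real)
    then show "of_real x powr (s - 1) *
        of_real (gen_hermite (2 * m + 1) \<mu> x * x powr \<mu> * exp (- x\<^sup>2 / 2)) =
      (2 * (- 4) ^ m * fact m) *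
      (of_real x powr (\<mu> + s + 1 - 1) * of_real (laguerre m (\<mu> + 1 / 2) (x\<^sup>2) * exp (- x\<^sup>2 / 2)))"
      by (simp add: gen_hermite_def four power_minus[of 4] mult_ac del: add_diff_cancel_right')
  qed simp
  also have "\<dots> = 2 * (- 4) ^ m * fact m * (LINT x:{0<..}|lborel.
      of_real x powr ((\<mu> + s + 1) - 1) * of_real (laguerre m (\<mu> + 1 / 2) (x\<^sup>2) * exp (- x\<^sup>2 / 2)))"
    by (rule set_integral_mult_right)
  also have "(LINT x:{0<..}|lborel.
      of_real x powr ((\<mu> + s + 1) - 1) * of_real (laguerre m (\<mu> + 1 / 2) (x\<^sup>2) * exp (- x\<^sup>2 / 2))) =
      2 powr ((\<mu> + s + 1) / 2 - 1) * Gamma ((\<mu> + s + 1) / 2) *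
      laguerre_mellin_coeff m ((\<mu> + s + 1) / 2) (of_real (\<mu> + 1 / 2) + 1)"
    by (rule mellin_laguerre_gaussian) (use assms in auto)
  finally show ?thesis by (simp add: add.assoc)
qed

section \<open>Summation of the generating function\<close>

lemma sums_even_odd:
  fixes f :: "nat \<Rightarrow> 'a::real_normed_vector"
  assumes "(\<lambda>n. f (2 * n)) sums x" and "(\<lambda>n. f (2 * n + 1)) sums y"
  shows "f sums (x + y)"
proof -
  have "(\<lambda>n. if even n then f n else 0) sums x"
    using assms(1) by (subst sums_mono_reindex[of "\<lambda>n. 2 * n", symmetric])
      (auto simp: strict_mono_def elim!: evenE)
  moreover have "(\<lambda>n. if odd n then f n else 0) sums y"
    using assms(2) by (subst sums_mono_reindex[of "\<lambda>n. 2 * n + 1", symmetric])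
      (auto simp: strict_mono_def elim!: oddE)
  ultimately have "(\<lambda>n. (if even n then f n else 0) + (if odd n then f n else 0)) sums (x + y)"
    by (rule sums_add)
  also have "(\<lambda>n. (if even n then f n else 0) + (if odd n then f n else 0)) = f"
    by auto
  finally show ?thesis .
qed

text \<open>Both arguments are below pi/2 in absolute value, so their sum does not reach the branch
  cut.\<close>

lemma csqrt_mult_Re_pos:
  assumes "Re u > 0" and "Re v > 0"
  shows "csqrt (u * v) = csqrt u * csqrt v"
proof -
  have uv: "u \<noteq> 0" "v \<noteq> 0" using assms by auto
  have "\<bar>Arg u\<bar> < pi / 2" "\<bar>Arg v\<bar> < pi / 2"
    using assms uv Re_Ln_pos_lt Arg_eq_Im_Ln by simp_all
  then show ?thesis
    by (intro csqrt_mult) auto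
qed

text \<open>The exponent of \<open>1 + 4 * t\<^sup>2\<close> stems from \<open>c - a\<close>, hence
  its dependence on \<mu>. The condition \<open>Re s + \<mu> > 0\<close> secures convergence of the
  integrals at 0.\<close>

theorem proposition3:
  fixes \<mu> :: real and s t :: complex
  assumes "\<mu> > - 1 / 2" and "Re s > 0" and "Re s + \<mu> > 0" and "norm t < 1 / 2"
  shows "(\<lambda>n. mellin_hermite n \<mu> s * (t ^ n / fact (n div 2))) sums
     (2 powr ((\<mu> + s - 3) / 2) *
      ((1 + 4 * t\<^sup>2) powr ((s - \<mu>) / 2 - 1) / (1 - 4 * t\<^sup>2) powr ((\<mu> + s + 1) / 2)) *
      (csqrt (2 * (1 - 16 * t ^ 4)) * Gamma ((\<mu> + s) / 2) + 4 * t * Gamma ((\<mu> + s + 1) / 2)))"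
proof -
  \<comment> \<open>With this choice \<open>u = 1 - w\<close> and \<open>v = 1 + w\<close>, and
    \<open>norm t < 1 / 2\<close> becomes \<open>norm w < 1\<close>, which puts \<open>u\<close> and
    \<open>v\<close> in the right half-plane.\<close>
  define w where "w = - 4 * t\<^sup>2"
  define u where "u = 1 + 4 * t\<^sup>2"
  define v where "v = 1 - 4 * t\<^sup>2"
  define f where "f n = mellin_hermite n \<mu> s * (t ^ n / fact (n div 2))" for n
  have "norm t ^ 2 < (1 / 2) ^ 2"
    using assms(4) by (intro power_strict_mono) auto
  then have w: "norm w < 1"
    by (simp add: w_def norm_mult norm_power power2_eq_square)
  then have uv: "Re u > 0" "Re v > 0"
    using abs_Re_le_cmod[of w] by (auto simp: w_def u_def v_def)
  \<comment> \<open>The division by \<open>fact (n div 2)\<close> cancels the factorial in the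
    transform, and \<open>(- 4) ^ m * t ^ (2 * m) = w ^ m\<close>.\<close>
  have f_even: "f (2 * m) = 2 powr ((\<mu> + s) / 2 - 1) * Gamma ((\<mu> + s) / 2) *
      (laguerre_mellin_coeff m ((\<mu> + s) / 2) (\<mu> + 1 / 2) * w ^ m)" for m
    unfolding f_def mellin_hermite_even[OF assms(1,3)]
    by (simp add: w_def power_mult power_mult_distrib power_minus[of "4 * _"] power_minus[of 4])
  have f_odd: "f (2 * m + 1) = 2 * t * 2 powr ((\<mu> + s + 1) / 2 - 1) * Gamma ((\<mu> + s + 1) / 2) *
      (laguerre_mellin_coeff m ((\<mu> + s + 1) / 2) (\<mu> + 3 / 2) * w ^ m)" for m
    unfolding f_def mellin_hermite_odd[OF assms(1,3)]
    by (simp add: w_def power_mult power_mult_distrib power_minus[of "4 * _"] power_minus[of 4])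
  have coeff_sums: "(\<lambda>m. laguerre_mellin_coeff m c a * w ^ m) sums (u powr (c - a) / v powr c)" for c a
    using laguerre_mellin_coeff_sums[OF w, of c a]
    by (simp add: w_def u_def v_def powr_minus field_simps)
  have even: "(\<lambda>m. f (2 * m)) sums (2 powr ((\<mu> + s) / 2 - 1) * Gamma ((\<mu> + s) / 2) *
      (u powr ((\<mu> + s) / 2 - (\<mu> + 1 / 2)) / v powr ((\<mu> + s) / 2)))"
    unfolding f_even by (intro sums_mult coeff_sums)
  have odd: "(\<lambda>m. f (2 * m + 1)) sums (2 * t * 2 powr ((\<mu> + s + 1) / 2 - 1) * Gamma ((\<mu> + s + 1) / 2) *
      (u powr ((\<mu> + s + 1) / 2 - (\<mu> + 3 / 2)) / v powr ((\<mu> + s + 1) / 2)))"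
    unfolding f_odd by (intro sums_mult coeff_sums)
  \<comment> \<open>\<open>U / V\<close> is the odd part's quotient of powers, and its constant
    \<open>2 * t * (2 * K)\<close> gives \<open>4 * t * K\<close>. The even part differs by square
    roots of 2, \<open>u\<close> and \<open>v\<close>, which combine to the root in the claim
    because \<open>u * v = 1 - 16 * t ^ 4\<close>.\<close>
  define K where "K = 2 powr ((\<mu> + s - 3) / 2)"
  define U where "U = u powr ((s - \<mu>) / 2 - 1)"
  define V where "V = v powr ((\<mu> + s + 1) / 2)"
  have "csqrt (2 * (1 - 16 * t ^ 4)) = csqrt (2 * (u * v))"
    by (simp add: u_def v_def algebra_simps power2_eq_square power4_eq_xxxx)
  also have "\<dots> = csqrt 2 * (csqrt u * csqrt v)"
    by (simp only: csqrt_mult_Re_pos[OF uv, symmetric] csqrt_mult[of 2] Arg_numeral) (simp add: csqrt_mult Arg_le_pi mpi_less_Arg)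
  finally have sqrt: "csqrt (2 * (1 - 16 * t ^ 4)) = 2 powr (1 / 2) * u powr (1 / 2) * v powr (1 / 2)"
    by (simp add: csqrt_conv_powr)
  have K2: "2 powr ((\<mu> + s) / 2 - 1) = K * 2 powr (1 / 2)"
    unfolding K_def by (simp add: field_simps flip: powr_add)
  have U2: "u powr ((\<mu> + s) / 2 - (\<mu> + 1 / 2)) = U * u powr (1 / 2)"
  proof -
    have "(\<mu> + s) / 2 - (\<mu> + 1 / 2) = (s - \<mu>) / 2 - 1 + 1 / 2"
      by (simp add: field_simps)
    then show ?thesis
      unfolding U_def by (simp only: powr_add)
  qed
  have V2: "1 / v powr ((\<mu> + s) / 2) = v powr (1 / 2) / V"
    using uv unfolding V_def by (auto simp: divide_simps add_ac simp flip: powr_add)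
  have K3: "2 powr ((\<mu> + s + 1) / 2 - 1) = 2 * K"
    unfolding K_def using powr_add[of "2::complex" 1 "(\<mu> + s - 3) / 2"] by (simp add: field_simps)
  have U3: "(\<mu> + s + 1) / 2 - (\<mu> + 3 / 2) = (s - \<mu>) / 2 - 1"
    by (simp add: field_simps)
  have "f sums (K * 2 powr (1 / 2) * Gamma ((\<mu> + s) / 2) * (U * u powr (1 / 2) * (v powr (1 / 2) / V)) +
      2 * t * (2 * K) * Gamma ((\<mu> + s + 1) / 2) * (U / V))"
    using sums_even_odd[OF even odd]
    by (simp only: U3 K2 U2 K3 flip: U_def V_def V2) (simp add: field_simps)
  also have "\<dots> = K * (U / V) *
      (csqrt (2 * (1 - 16 * t ^ 4)) * Gamma ((\<mu> + s) / 2) + 4 * t * Gamma ((\<mu> + s + 1) / 2))"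
    unfolding sqrt by (simp add: algebra_simps)
  finally show ?thesis
    unfolding f_def K_def U_def V_def u_def v_def .
qed

end
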